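(* Let $m,d\ge1$ be coprime integers. Then the number of partitions that are simultaneously $m$-cores, $(m+d)$-cores and $(m+2d)$-cores is $$\sum_{\lambda\in \mathcal{C}_m\cap\mathcal{C}_{m+d}\cap\mathcal{C}_{m+2d}} 1 = \frac{1}{m+d}\sum_{i=0}^{\lfloor m/2\rfloor}\binom{m+d}{i,\,i+d,\,m-2i}.$$
   Context: A partition is an infinite weakly decreasing sequence $\lambda=(\lambda_1,\lambda_2,\ldots)$ of nonnegative integers with finite sum. Its Young diagram is $[\lambda]=\{(r,c)\in\mathbb{Z}_{>0}^2 : c\le\lambda_r\}$, its conjugate $\overline{\lambda}$ is given by $\overline{\lambda}_r=\#\{c\in\mathbb{Z}_{>0}: r\le\lambda_c\}$, and the hook length at $(r,c)\in[\lambda]$ is $1+(\lambda_r-r)+(\overline{\lambda}_c-c)$. For $s\ge1$, a partition is an $s$-core if it has no hook of length $s$; $\mathcal{C}_s$ is the set of $s$-cores. The symbol $\binom{n}{a,b,c}=\frac{n!}{a!\,b!\,c!}$ (with $a+b+c=n$) is a multinomial coefficient. *)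

theory Defs
  imports Complex_Main
begin

text \<open>
  Sequences \<open>(\<lambda>\<^sub>1, \<lambda>\<^sub>2, \<dots>)\<close> are functions on \<open>nat\<close> read at the positive indices only.
  The unused value at index 0 is fixed to 0, so that each partition has exactly one representative
  and counting is meaningful.
\<close>

definition partitions :: "(nat \<Rightarrow> nat) set" where
  "partitions = {lam. lam 0 = 0 \<and> (\<forall>r\<ge>1. lam (Suc r) \<le> lam r) \<and> summable (\<lambda>r. real (lam r))}"

definition young_diagram :: "(nat \<Rightarrow> nat) \<Rightarrow> (nat \<times> nat) set" where
  "young_diagram lam = {(r, c). 1 \<le> r \<and> 1 \<le> c \<and> c \<le> lam r}"

text \<open>
  The set is finite for every partition and every \<open>r \<ge> 1\<close>. At \<open>r = 0\<close> it is infinite, so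
  its \<open>card\<close> is 0, in accordance with the convention at index 0.
\<close>

definition conjugate :: "(nat \<Rightarrow> nat) \<Rightarrow> nat \<Rightarrow> nat" where
  "conjugate lam r = card {c. 1 \<le> c \<and> r \<le> lam c}"

text \<open>Integer-valued, since \<open>\<lambda>\<^sub>r - r\<close> can be negative.\<close>

definition hook_length :: "(nat \<Rightarrow> nat) \<Rightarrow> nat \<Rightarrow> nat \<Rightarrow> int" where
  "hook_length lam r c = 1 + (int (lam r) - int r) + (int (conjugate lam c) - int c)"

definition cores :: "nat \<Rightarrow> (nat \<Rightarrow> nat) set" where
  "cores s = {lam \<in> partitions. \<forall>(r, c) \<in> young_diagram lam. hook_length lam r c \<noteq> int s}"

text \<open>Meaningful only for \<open>a + b + c = n\<close>.\<close>

definition multinomial :: "nat \<Rightarrow> nat \<Rightarrow> nat \<Rightarrow> nat \<Rightarrow> real" where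
  "multinomial n a b c = fact n / (fact a * fact b * fact c)"

end

theory Submission
  imports Defs "HOL-Library.Infinite_Set" "HOL-Number_Theory.Cong"
begin

text \<open>
  A partition is encoded by its bead set \<open>B = {\<lambda>\<^sub>r - r | r \<ge> 1}\<close>. The gaps of \<open>B\<close> are the numbers
  \<open>c - 1 - \<lambda>'\<^sub>c\<close>, where \<open>\<lambda>'\<close> is the conjugate, so hook lengths are the differences between a bead
  and a smaller gap, and \<open>\<lambda>\<close> is an \<open>s\<close>-core iff \<open>B\<close> is closed under subtracting \<open>s\<close>. Every subset of
  the integers that is bounded above and contains all sufficiently negative integers is a shift of
  exactly one bead set.

  Put \<open>n = m + d\<close> and let \<open>L x\<close> be the largest \<open>i\<close> with \<open>x + i n \<in> B\<close>. Then \<open>L (x + n) = L x - 1\<close>, and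
  closure under subtracting \<open>m = n - d\<close> and \<open>m + 2 d = n + d\<close> says that \<open>L (x + d) - L x\<close> lies in
  \<open>{-1, 0, 1}\<close>. Walking from \<open>x\<close> in \<open>n\<close> steps of size \<open>d\<close> therefore gives a sequence of \<open>n\<close> such
  increments with sum \<open>-d\<close>. As \<open>d\<close> is coprime to \<open>n\<close>, the walk visits all residues, so the sequence
  determines \<open>B\<close> up to a shift. Hence pairs of a core and a starting residue correspond
  bijectively to these sequences, and the sequences with \<open>i\<close> entries \<open>1\<close> are counted by the
  multinomial coefficient of \<open>(i, i + d, m - 2 i)\<close>.
\<close>

section \<open>Bead sets, gaps and the core criterion\<close>

definition beads :: "(nat \<Rightarrow> nat) \<Rightarrow> int set" where
  "beads lam = (\<lambda>r. int (lam r) - int r) ` {1..}"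

lemma beads_eq_range: "beads lam = range (\<lambda>k. int (lam (Suc k)) - int (Suc k))"
proof -
  have "{1..} = range Suc"
    by (auto simp: image_iff) (metis Suc_le_D)
  then show ?thesis
    by (simp only: beads_def image_image)
qed

lemma partitions_antimono:
  assumes "lam \<in> partitions" "1 \<le> r" "r \<le> s"
  shows "lam s \<le> lam r"
  using assms(3)
proof (induction rule: dec_induct)
  case (step k)
  then have "lam (Suc k) \<le> lam k"
    using assms(1,2) by (auto simp: partitions_def)
  with step.IH show ?case by simp
qed simp

lemma partitions_eventually_0:
  assumes "lam \<in> partitions"
  obtains N where "\<And>r. r \<ge> N \<Longrightarrow> lam r = 0"
proof -
  have "(\<lambda>r. real (lam r)) \<longlonglongrightarrow> 0"
    using assms by (auto simp: partitions_def intro: summable_LIMSEQ_zero)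
  then have "\<forall>\<^sub>F r in sequentially. real (lam r) < 1"
    by (rule order_tendstoD) simp
  then show ?thesis
    using that by (auto simp: eventually_sequentially)
qed

lemma partitionsI:
  assumes "lam 0 = 0" "\<And>r. r \<ge> 1 \<Longrightarrow> lam (Suc r) \<le> lam r" "\<And>r. r \<ge> N \<Longrightarrow> lam r = 0"
  shows "lam \<in> partitions"
proof -
  have "summable (\<lambda>r. real (lam r))"
    by (rule summable_finite[of "{..<N}"]) (use assms(3) in \<open>auto simp: not_less\<close>)
  with assms(1,2) show ?thesis by (simp add: partitions_def)
qed

text \<open>Such a set is the interval \<open>{1..card S}\<close>. This turns the cardinality in
  \<open>conjugate\<close>, and later the number of beads above a given integer, into a condition on
  single rows.\<close>

lemma le_card_downset_iff:
  fixes S :: "nat set"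
  assumes "finite S" "0 \<notin> S" and down: "\<And>a b. b \<in> S \<Longrightarrow> 1 \<le> a \<Longrightarrow> a \<le> b \<Longrightarrow> a \<in> S"
    and "1 \<le> r"
  shows "r \<le> card S \<longleftrightarrow> r \<in> S"
proof -
  have "S = {1..card S}"
  proof (cases "S = {}")
    case False
    have "S = {1..Max S}"
    proof
      show "S \<subseteq> {1..Max S}"
        using assms(1,2) by (auto simp: Suc_le_eq intro: gr0I)
      show "{1..Max S} \<subseteq> S"
        using down[OF Max_in[OF assms(1) False]] by auto
    qed
    then show ?thesis
      by (metis card_atLeastAtMost diff_Suc_1)
  qed simp
  then show ?thesis
    using assms(4) by (metis atLeastAtMost_iff)
qed

text \<open>The rows reaching column \<open>c\<close> form a downward closed set because
  \<open>lam\<close> decreases, and a finite one because \<open>lam\<close> vanishes eventually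
  while \<open>c\<close> is positive.\<close>

lemma le_conjugate_iff:
  assumes "lam \<in> partitions" "1 \<le> r" "1 \<le> c"
  shows "r \<le> conjugate lam c \<longleftrightarrow> c \<le> lam r"
proof -
  obtain N where N: "\<And>r. r \<ge> N \<Longrightarrow> lam r = 0"
    using partitions_eventually_0[OF assms(1)] by blast
  have "{r. 1 \<le> r \<and> c \<le> lam r} \<subseteq> {..<N}"
    using N assms(3) by (auto simp: not_less[symmetric]) (metis not_less not_one_le_zero order_trans)
  then have "finite {r. 1 \<le> r \<and> c \<le> lam r}"
    using finite_subset by blast
  then have "r \<le> card {r. 1 \<le> r \<and> c \<le> lam r} \<longleftrightarrow> r \<in> {r. 1 \<le> r \<and> c \<le> lam r}"
    by (rule le_card_downset_iff)
      (use assms(2) partitions_antimono[OF assms(1)] in \<open>auto intro: order_trans\<close>)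
  with assms(2) show ?thesis by (simp add: conjugate_def)
qed

text \<open>If \<open>c \<le> lam r\<close>, then also \<open>r \<le> conjugate lam c\<close>, and
  adding the two gives the inequality; otherwise both fail by at least 1, so the bead lies strictly
  below the gap.\<close>

lemma le_row_iff_gap_less:
  assumes "lam \<in> partitions" "1 \<le> r" "1 \<le> c"
  shows "c \<le> lam r \<longleftrightarrow> int c - 1 - int (conjugate lam c) < int (lam r) - int r"
  using le_conjugate_iff[OF assms] by linarith

lemma gap_notin_beads:
  assumes "lam \<in> partitions" "1 \<le> c"
  shows "int c - 1 - int (conjugate lam c) \<notin> beads lam"
proof
  assume "int c - 1 - int (conjugate lam c) \<in> beads lam"
  then obtain r where "1 \<le> r" "int c - 1 - int (conjugate lam c) = int (lam r) - int r"
    by (auto simp: beads_def)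
  with le_conjugate_iff[OF assms(1) _ assms(2), of r] show False by linarith
qed

text \<open>Let \<open>k\<close> be the number of beads above \<open>y\<close>. Then
  \<open>y\<close> lies strictly between the beads of rows \<open>k + 1\<close> and
  \<open>k\<close>, which forces the column \<open>c = y + 1 + k\<close> to have length exactly
  \<open>k\<close>.\<close>

lemma notin_beads_imp_gap:
  assumes "lam \<in> partitions" "y \<notin> beads lam"
  obtains c where "1 \<le> c" "y = int c - 1 - int (conjugate lam c)"
proof -
  obtain N where N: "\<And>r. r \<ge> N \<Longrightarrow> lam r = 0"
    using partitions_eventually_0[OF assms(1)] by blast
  define S where "S = {r. 1 \<le> r \<and> int (lam r) - int r > y}"
  \<comment> \<open>From row \<open>N\<close> on the bead of row \<open>r\<close> is
    \<open>- r\<close>, and it is at most \<open>y\<close> once \<open>r \<ge> - y\<close>.\<close>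
  have "S \<subseteq> {..<max N (nat (- y))}"
  proof
    fix r assume r: "r \<in> S"
    show "r \<in> {..<max N (nat (- y))}"
    proof (rule ccontr)
      assume "\<not> ?thesis"
      then have "lam r = 0" "int r \<ge> - y" using N by auto
      with r show False by (simp add: S_def)
    qed
  qed
  then have "finite S" using finite_subset by blast
  have S: "r \<le> card S \<longleftrightarrow> int (lam r) - int r > y" if "1 \<le> r" for r
  proof -
    have "r \<le> card S \<longleftrightarrow> r \<in> S"
    proof (rule le_card_downset_iff[OF \<open>finite S\<close> _ _ that])
      fix a b assume ab: "b \<in> S" "1 \<le> a" "a \<le> b"
      then have "lam b \<le> lam a" using partitions_antimono[OF assms(1)] by simp
      with ab show "a \<in> S" by (simp add: S_def)
    qed (simp add: S_def)
    with that show ?thesis by (simp add: S_def)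
  qed
  define k where "k = card S"
  have "int (lam (Suc k)) - int (Suc k) \<noteq> y"
    using assms(2) unfolding beads_eq_range by blast
  with S[of "Suc k"] have lt: "int (lam (Suc k)) - int (Suc k) < y"
    by (simp add: k_def)
  define c where "c = nat (y + 1 + int k)"
  have c: "1 \<le> c" "int c = y + 1 + int k" using lt by (auto simp: c_def)
  have "conjugate lam c = k"
  proof (rule antisym)
    have "\<not> Suc k \<le> conjugate lam c"
      using lt c le_conjugate_iff[OF assms(1) _ c(1), of "Suc k"] by simp
    then show "conjugate lam c \<le> k" by simp
    show "k \<le> conjugate lam c"
    proof (cases "k = 0")
      case False
      then have "int (lam k) - int k > y" using S[of k] by (simp add: k_def)
      with c False show ?thesis
        using le_conjugate_iff[OF assms(1) _ c(1), of k] by simp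
    qed simp
  qed
  with c that show ?thesis by simp
qed

text \<open>A failure of closure is a bead \<open>b\<close> whose translate \<open>b - s\<close> is
  a gap. As \<open>s\<close> is positive, the gap lies below the bead, so the row of
  \<open>b\<close> and the column of the gap meet in a box of the diagram, with hook length
  \<open>s\<close>.\<close>

lemma cores_iff_beads_closed:
  assumes "lam \<in> partitions" "1 \<le> s"
  shows "lam \<in> cores s \<longleftrightarrow> (\<forall>b\<in>beads lam. b - int s \<in> beads lam)"
proof
  assume core: "lam \<in> cores s"
  show "\<forall>b\<in>beads lam. b - int s \<in> beads lam"
  proof (rule ballI, rule ccontr)
    fix b assume "b \<in> beads lam" and notin: "b - int s \<notin> beads lam"
    then obtain r where r: "1 \<le> r" "b = int (lam r) - int r"
      by (auto simp: beads_def)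
    obtain c where c: "1 \<le> c" "b - int s = int c - 1 - int (conjugate lam c)"
      using notin_beads_imp_gap[OF assms(1) notin] .
    have "c \<le> lam r"
      using le_row_iff_gap_less[OF assms(1) r(1) c(1)] r(2) c(2) assms(2) by linarith
    then have "hook_length lam r c \<noteq> int s"
      using core r c by (auto simp: cores_def young_diagram_def)
    with r c show False by (simp add: hook_length_def)
  qed
next
  assume closed: "\<forall>b\<in>beads lam. b - int s \<in> beads lam"
  have "hook_length lam r c \<noteq> int s" if "1 \<le> r" "1 \<le> c" "c \<le> lam r" for r c
  proof
    assume "hook_length lam r c = int s"
    then have "(int (lam r) - int r) - int s = int c - 1 - int (conjugate lam c)"
      by (simp add: hook_length_def)
    moreover have "int (lam r) - int r \<in> beads lam"
      using that by (auto simp: beads_def)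
    ultimately show False
      using closed gap_notin_beads[OF assms(1) that(2)] by metis
  qed
  with assms(1) show "lam \<in> cores s"
    by (auto simp: cores_def young_diagram_def)
qed

section \<open>Shifts of bead sets\<close>

text \<open>These sets are the Maya diagrams of arbitrary charge; bead sets of partitions are those
  of one fixed charge.\<close>

definition bead_config :: "int set \<Rightarrow> bool" where
  "bead_config B \<longleftrightarrow> (\<exists>K M. {..K} \<subseteq> B \<and> B \<subseteq> {..M})"

lemma bead_config_beads:
  assumes "lam \<in> partitions"
  shows "bead_config (beads lam)"
proof -
  obtain N where N: "\<And>r. r \<ge> N \<Longrightarrow> lam r = 0"
    using partitions_eventually_0[OF assms] by blast
  have "{..- int (Suc N)} \<subseteq> beads lam"
  proof
    fix x assume x: "x \<in> {..- int (Suc N)}"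
    have "x = int (lam (nat (- x))) - int (nat (- x))" "nat (- x) \<ge> 1"
      using N[of "nat (- x)"] x by auto
    then show "x \<in> beads lam" unfolding beads_def by blast
  qed
  moreover have "beads lam \<subseteq> {..int (lam 1)}"
  proof
    fix x assume "x \<in> beads lam"
    then obtain r where "1 \<le> r" "x = int (lam r) - int r" by (auto simp: beads_def)
    with partitions_antimono[OF assms, of 1 r] show "x \<in> {..int (lam 1)}" by simp
  qed
  ultimately show ?thesis by (auto simp: bead_config_def)
qed

text \<open>By strong induction: \<open>f k = g i\<close> with \<open>i < k\<close> would give
  \<open>f k = f i\<close>, against strict decrease. So \<open>f k \<le> g k\<close>, and the
  converse is symmetric.\<close>

lemma strict_antimono_range_eq:
  fixes f g :: "nat \<Rightarrow> int"
  assumes f: "\<And>i j. i < j \<Longrightarrow> f j < f i" and g: "\<And>i j. i < j \<Longrightarrow> g j < g i"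
    and eq: "range f = range g"
  shows "f k = g k"
proof (induction k rule: less_induct)
  case (less k)
  obtain i where i: "f k = g i" using eq by (metis rangeE rangeI)
  obtain j where j: "g k = f j" using eq by (metis rangeE rangeI)
  have "\<not> i < k" using less[of i] f[of i k] i by auto
  then have "f k \<le> g k" using g[of k i] i by (cases "k = i") auto
  have "\<not> j < k" using less[of j] g[of j k] j by auto
  then have "g k \<le> f k" using f[of k j] j by (cases "k = j") auto
  with \<open>f k \<le> g k\<close> show ?case by simp
qed

text \<open>Both sets are listed in strictly decreasing order by the rows, so the listings agree up
  to \<open>t\<close>. In rows where both partitions vanish this forces
  \<open>t = 0\<close>.\<close>

lemma beads_shift_unique:
  assumes lam: "lam \<in> partitions" and mu: "mu \<in> partitions"
    and eq: "\<And>x. x \<in> beads lam \<longleftrightarrow> x + t \<in> beads mu"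
  shows "lam = mu \<and> t = 0"
proof -
  define f where "f k = int (lam (Suc k)) - int (Suc k) + t" for k
  define g where "g k = int (mu (Suc k)) - int (Suc k)" for k
  have "range g = beads mu"
    unfolding beads_eq_range g_def ..
  have "range f = (\<lambda>x. x + t) ` beads lam"
    unfolding beads_eq_range f_def image_image ..
  also have "\<dots> = beads mu"
  proof
    show "(\<lambda>x. x + t) ` beads lam \<subseteq> beads mu" using eq by auto
    show "beads mu \<subseteq> (\<lambda>x. x + t) ` beads lam"
    proof
      fix y assume "y \<in> beads mu"
      with eq[of "y - t"] show "y \<in> (\<lambda>x. x + t) ` beads lam"
        by (intro image_eqI[of _ _ "y - t"]) auto
    qed
  qed
  finally have ranges: "range f = range g" using \<open>range g = beads mu\<close> by simp
  have fg: "f k = g k" for k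
  proof (rule strict_antimono_range_eq[OF _ _ ranges])
    fix i j :: nat assume "i < j"
    then show "f j < f i" using partitions_antimono[OF lam, of "Suc i" "Suc j"]
      by (simp add: f_def)
    show "g j < g i" using \<open>i < j\<close> partitions_antimono[OF mu, of "Suc i" "Suc j"]
      by (simp add: g_def)
  qed
  obtain N where N: "\<And>r. r \<ge> N \<Longrightarrow> lam r = 0"
    using partitions_eventually_0[OF lam] by blast
  obtain N' where N': "\<And>r. r \<ge> N' \<Longrightarrow> mu r = 0"
    using partitions_eventually_0[OF mu] by blast
  have "t = 0"
    using fg[of "max N N'"] N[of "Suc (max N N')"] N'[of "Suc (max N N')"]
    by (simp add: f_def g_def)
  moreover have "lam r = mu r" for r
  proof (cases r)
    case 0
    with lam mu show ?thesis by (simp add: partitions_def)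
  next
    case (Suc k)
    with fg[of k] \<open>t = 0\<close> show ?thesis by (simp add: f_def g_def)
  qed
  ultimately show ?thesis by blast
qed

text \<open>List the elements of \<open>B\<close> downward from the bound \<open>M\<close>. The row
  belonging to an element is the number of gaps below it, which is finite and weakly decreasing
  along the list.\<close>

lemma bead_config_shift_of_partition:
  assumes "bead_config B"
  obtains lam t where "lam \<in> partitions" "\<And>x. x \<in> beads lam \<longleftrightarrow> x + t \<in> B"
proof -
  obtain K M where K: "{..K} \<subseteq> B" and M: "B \<subseteq> {..M}"
    using assms by (auto simp: bead_config_def)
  define S where "S = {k. M - int k \<in> B}"
  define N where "N = nat (M - K)"
  have S: "k \<in> S" if "k \<ge> N" for k
  proof -
    have "M - int k \<le> K" using that by (auto simp: N_def)
    with K show ?thesis by (auto simp: S_def)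
  qed
  have "infinite S"
    unfolding infinite_nat_iff_unbounded_le by (meson S nle_le)
  define e where "e = enumerate S"
  have e_mono: "e k < e (Suc k)" for k
    using \<open>infinite S\<close> by (simp add: e_def enumerate_step)
  have range_e: "range e = S"
    using \<open>infinite S\<close> by (simp add: e_def range_enumerate)
  have e_Suc: "e (Suc k) = Suc (e k)" if "k \<ge> N" for k
  proof (rule antisym)
    have "Suc (e k) \<in> S"
      using le_enumerate[OF \<open>infinite S\<close>, of k] that by (intro S) (simp add: e_def)
    then show "e (Suc k) \<le> Suc (e k)"
      unfolding e_def enumerate_Suc''[OF \<open>infinite S\<close>] by (intro Least_le) simp
    show "Suc (e k) \<le> e (Suc k)" using e_mono[of k] by simp
  qed
  \<comment> \<open>This is the total number of gaps of \<open>B\<close> up to \<open>M\<close>.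
    Since \<open>e k - k\<close> of them precede the \<open>k\<close>-th element in the list,
    \<open>k + c - e k\<close> remain below it.\<close>
  define c where "c = e N - N"
  have "e N \<ge> N" using le_enumerate[OF \<open>infinite S\<close>] by (simp add: e_def)
  have e_late: "e k = k + c" if "k \<ge> N" for k
    using that
  proof (induction rule: dec_induct)
    case base
    show ?case using \<open>e N \<ge> N\<close> by (simp add: c_def)
  next
    case (step k)
    then show ?case using e_Suc[of k] by simp
  qed
  have e_le: "e k \<le> k + c" for k
  proof (cases "k \<ge> N")
    case False
    then have "k \<le> N" by simp
    then show ?thesis
    proof (induction rule: inc_induct)
      case base
      show ?case using e_late[of N] by simp
    next
      case (step k)
      then show ?case using e_mono[of k] by simp
    qed
  qed (simp add: e_late)
  define lam where "lam r = (case r of 0 \<Rightarrow> 0 | Suc k \<Rightarrow> k + c - e k)" for r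
  have lam_Suc: "int (lam (Suc k)) - int (Suc k) = int c - 1 - int (e k)" for k
    using e_le[of k] by (simp add: lam_def of_nat_diff)
  show ?thesis
  proof
    show "lam \<in> partitions"
    proof (rule partitionsI[where N = "Suc N"])
      fix r :: nat assume "r \<ge> 1"
      then obtain k where "r = Suc k" by (cases r) auto
      then show "lam (Suc r) \<le> lam r" using e_mono[of k] by (simp add: lam_def)
    next
      fix r assume "r \<ge> Suc N"
      then show "lam r = 0" using e_late by (cases r) (auto simp: lam_def)
    qed (simp add: lam_def)
    have "beads lam = (\<lambda>k. int c - 1 - int k) ` S"
      unfolding beads_eq_range range_e[symmetric] image_image lam_Suc ..
    moreover have "x \<in> (\<lambda>k. int c - 1 - int k) ` S \<longleftrightarrow> x + (M + 1 - int c) \<in> B" for x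
    proof
      assume B: "x + (M + 1 - int c) \<in> B"
      then have "x \<le> int c - 1" using M by auto
      with B show "x \<in> (\<lambda>k. int c - 1 - int k) ` S"
        by (intro image_eqI[of _ _ "nat (int c - 1 - x)"]) (auto simp: S_def algebra_simps)
    qed (auto simp: S_def)
    ultimately show "\<And>x. x \<in> beads lam \<longleftrightarrow> x + (M + 1 - int c) \<in> B" by blast
  qed
qed

section \<open>Levels on residue classes\<close>

text \<open>The defining equivalence says more than a maximum would: there are no holes below
  \<open>k\<close>. It determines a value only if such a \<open>k\<close> exists, as for a
  \<open>bead_config\<close> closed under subtracting a positive \<open>n\<close>.\<close>

definition level :: "int \<Rightarrow> int set \<Rightarrow> int \<Rightarrow> int" where
  "level n B x = (THE k. \<forall>i. x + i * n \<in> B \<longleftrightarrow> i \<le> k)"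

lemma level_eqI:
  assumes "\<And>i. x + i * n \<in> B \<longleftrightarrow> i \<le> k"
  shows "level n B x = k"
  unfolding level_def
proof (rule the_equality)
  fix l assume "\<forall>i. x + i * n \<in> B \<longleftrightarrow> i \<le> l"
  with assms show "l = k" by (metis order.antisym order.refl)
qed (use assms in blast)

text \<open>Closure makes the set of admissible \<open>i\<close> downward closed, and the bounds on
  \<open>B\<close> make it nonempty and bounded above. Its maximum is taken over the finite window
  from \<open>lo\<close> to \<open>hi\<close>, valid since \<open>n \<ge> 1\<close>.\<close>

lemma le_level_iff:
  fixes n :: int
  assumes "bead_config B" "n > 0" and closed: "\<And>b. b \<in> B \<Longrightarrow> b - n \<in> B"
  shows "i \<le> level n B x \<longleftrightarrow> x + i * n \<in> B"
proof -
  obtain K M where K: "{..K} \<subseteq> B" and M: "B \<subseteq> {..M}"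
    using assms by (auto simp: bead_config_def)
  have down: "x + (i - int k) * n \<in> B" if "x + i * n \<in> B" for i k
  proof (induction k)
    case (Suc k)
    from closed[OF this] show ?case by (simp add: algebra_simps)
  qed (use that in simp)
  have down': "x + j * n \<in> B" if "x + i * n \<in> B" "j \<le> i" for i j
    using down[OF that(1), of "nat (i - j)"] that(2) by simp
  define lo where "lo = - \<bar>K - x\<bar>"
  define hi where "hi = \<bar>M - x\<bar>"
  have lo: "x + lo * n \<in> B"
  proof -
    have "\<bar>K - x\<bar> * 1 \<le> \<bar>K - x\<bar> * n" using assms(2) by (intro mult_left_mono) auto
    then have "x + lo * n \<le> K" unfolding lo_def by simp
    with K show ?thesis by auto
  qed
  have hi: "i \<le> hi" if "x + i * n \<in> B" for i
  proof (rule ccontr)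
    assume "\<not> i \<le> hi"
    then have "i > 0" "i > \<bar>M - x\<bar>" by (auto simp: hi_def)
    moreover have "i * 1 \<le> i * n" using assms(2) \<open>i > 0\<close> by (intro mult_left_mono) auto
    ultimately have "x + i * n > M" by linarith
    with M that show False by auto
  qed
  define A where "A = {i \<in> {lo..hi}. x + i * n \<in> B}"
  have "finite A" unfolding A_def by (rule finite_subset[of _ "{lo..hi}"]) auto
  moreover have "lo \<in> A" using lo hi by (simp add: A_def)
  ultimately have A: "finite A" "lo \<in> A" .
  have "x + i * n \<in> B \<longleftrightarrow> i \<le> Max A" for i
  proof
    assume i: "x + i * n \<in> B"
    show "i \<le> Max A"
    proof (cases "lo \<le> i")
      case True
      with i hi have "i \<in> A" by (simp add: A_def)
      with A show ?thesis by simp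
    next
      case False
      with Max_ge[OF A] show ?thesis by simp
    qed
  next
    assume "i \<le> Max A"
    moreover have "x + Max A * n \<in> B" using Max_in[of A] A by (auto simp: A_def)
    ultimately show "x + i * n \<in> B" by (rule down'[rotated])
  qed
  then have "level n B x = Max A" "x + i * n \<in> B \<longleftrightarrow> i \<le> Max A" by (auto intro: level_eqI)
  then show ?thesis by simp
qed

lemma level_add_multiple:
  fixes n :: int
  assumes "bead_config B" "n > 0" "\<And>b. b \<in> B \<Longrightarrow> b - n \<in> B"
  shows "level n B (x + k * n) = level n B x - k"
proof (rule level_eqI)
  fix i
  show "x + k * n + i * n \<in> B \<longleftrightarrow> i \<le> level n B x - k"
    using le_level_iff[OF assms, of "k + i" x] by (simp add: algebra_simps)
qed

text \<open>Subtracting \<open>m\<close> from the top bead over \<open>x\<close> gives a bead over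
  \<open>x + d\<close> one level lower; subtracting \<open>m + 2 * d\<close> from the top bead over
  \<open>x + d\<close> gives one over \<open>x\<close>, again one level lower.\<close>

lemma level_step_le:
  fixes m d :: int
  assumes "bead_config B" "m + d > 0" "\<And>b. b \<in> B \<Longrightarrow> b - (m + d) \<in> B"
    and "\<And>b. b \<in> B \<Longrightarrow> b - m \<in> B" "\<And>b. b \<in> B \<Longrightarrow> b - (m + 2 * d) \<in> B"
  shows "\<bar>level (m + d) B (x + d) - level (m + d) B x\<bar> \<le> 1"
proof -
  note iff = le_level_iff[OF assms(1-3)]
  let ?L = "level (m + d) B"
  have "x + ?L x * (m + d) - m \<in> B" using assms(4) iff[of "?L x" x] by auto
  then have "x + d + (?L x - 1) * (m + d) \<in> B" by (simp add: algebra_simps)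
  then have "?L x - 1 \<le> ?L (x + d)" using iff by blast
  moreover have "x + d + ?L (x + d) * (m + d) - (m + 2 * d) \<in> B"
    using assms(5) iff[of "?L (x + d)" "x + d"] by blast
  then have "x + (?L (x + d) - 1) * (m + d) \<in> B" by (simp add: algebra_simps)
  then have "?L (x + d) - 1 \<le> ?L x" using iff by blast
  ultimately show ?thesis by linarith
qed

section \<open>Walks with increments -1, 0 and 1\<close>

text \<open>
  A sequence of increments in \<open>{-1, 0, 1}\<close> is represented by the pair of the sets of positions of
  its entries \<open>1\<close> and \<open>-1\<close>.
\<close>

definition height :: "nat set \<Rightarrow> nat set \<Rightarrow> nat \<Rightarrow> int" where
  "height P Q j = (\<Sum>i<j. of_bool (i \<in> P) - of_bool (i \<in> Q))"

lemma height_full: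
  assumes "P \<subseteq> {..<n}" "Q \<subseteq> {..<n}"
  shows "height P Q n = int (card P) - int (card Q)"
proof -
  have "(\<Sum>i<n. of_bool (i \<in> A)) = int (card A)" if "A \<subseteq> {..<n}" for A
    using that by (simp add: of_bool_def sum.If_cases Int_absorb1)
  with assms show ?thesis by (simp add: height_def sum_subtractf)
qed

text \<open>With \<open>u\<close> an inverse of \<open>d\<close> modulo \<open>n\<close>, the number
  of steps is \<open>j = (x * u) mod n\<close>.\<close>

lemma coprime_int_representation:
  fixes d n x :: int
  assumes "coprime d n" "n > 0"
  obtains j :: nat and k :: int where "j < n" "x = int j * d + k * n"
proof -
  obtain u where "[d * u = 1] (mod n)"
    using assms(1) cong_solve_coprime_int by blast
  then have "[x * u * d = x] (mod n)"
    using cong_scalar_left[of "d * u" 1 n x] by (simp add: ac_simps)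
  then have "(x * u) mod n * d mod n = x mod n"
    by (simp add: cong_def mod_mult_left_eq)
  then obtain k where "x = (x * u) mod n * d + k * n"
    using mod_eqE by (metis mult.commute)
  with that[of "nat ((x * u) mod n)" k] assms(2) show ?thesis by simp
qed

text \<open>The heights prescribe \<open>L\<close> at \<open>j * d\<close> for \<open>j < n\<close>,
  one point in each residue class, and the rule for translation by \<open>n\<close> extends it. At
  \<open>j = n\<close> that rule gives \<open>L 0 - d\<close>, which is the prescribed total
  height.\<close>

lemma height_extension:
  fixes n d :: nat
  assumes "coprime d n" "n > 0" "height P Q n = - int d"
  obtains L :: "int \<Rightarrow> int" where "\<And>j. j \<le> n \<Longrightarrow> L (int j * int d) = height P Q j"
    "\<And>x k. L (x + k * int n) = L x - k"
proof -
  obtain u where u: "[int d * u = 1] (mod int n)"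
    using assms(1) cong_solve_coprime_int by (metis coprime_int_iff)
  define r where "r x = (x * u) mod int n" for x
  \<comment> \<open>The division is exact: \<open>r x\<close> is the \<open>j\<close> in \<open>{0..<n}\<close> with \<open>x \<equiv> j d\<close> modulo \<open>n\<close>.\<close>
  define L where "L x = height P Q (nat (r x)) - (x - r x * int d) div int n" for x
  have per: "L (x + k * int n) = L x - k" for x k
  proof -
    have "r (x + k * int n) = r x"
      by (simp add: r_def distrib_right mult.assoc) (metis mod_mult_self2 mult.left_commute)
    moreover have "(x + k * int n - r x * int d) div int n = (x - r x * int d) div int n + k"
      using assms(2) by (metis add_diff_eq add.commute div_mult_self1 diff_add_eq of_nat_0_eq_iff neq0_conv)
    ultimately show ?thesis by (simp add: L_def)
  qed
  have lt: "L (int j * int d) = height P Q j" if "j < n" for j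
  proof -
    have "[int j * int d * u = int j] (mod int n)"
      using cong_scalar_left[OF u, of "int j"] by (simp add: mult.assoc)
    then have "r (int j * int d) = int j"
      using that by (simp add: r_def cong_def)
    then show ?thesis by (simp add: L_def)
  qed
  have "L (int n * int d) = height P Q n"
    using per[of 0 "int d"] lt[of 0] assms(2,3) by (simp add: height_def mult.commute)
  with lt have "L (int j * int d) = height P Q j" if "j \<le> n" for j
    using that by (cases "j = n") auto
  with per that show ?thesis by blast
qed

definition steps :: "nat \<Rightarrow> int \<Rightarrow> (int \<Rightarrow> int) \<Rightarrow> int \<Rightarrow> int \<Rightarrow> nat set" where
  "steps n d L x s = {j. j < n \<and> L (x + int (Suc j) * d) - L (x + int j * d) = s}"

text \<open>An increment in \<open>{-1, 0, 1}\<close> is the difference of the two indicators, so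
  the sum telescopes.\<close>

lemma height_steps:
  assumes "\<And>x. \<bar>L (x + d) - L x\<bar> \<le> 1" "j \<le> n"
  shows "height (steps n d L x 1) (steps n d L x (- 1)) j = L (x + int j * d) - L x"
  using assms(2)
proof (induction j)
  case 0
  show ?case by (simp add: height_def)
next
  case (Suc j)
  let ?s = "L (x + int (Suc j) * d) - L (x + int j * d)"
  have "\<bar>?s\<bar> \<le> 1"
    using assms(1)[of "x + int j * d"] by (simp add: algebra_simps)
  then have "?s = of_bool (?s = 1) - of_bool (?s = - 1)"
    by (cases "?s = 1"; cases "?s = - 1") auto
  also have "\<dots> = of_bool (j \<in> steps n d L x 1) - of_bool (j \<in> steps n d L x (- 1))"
    using Suc.prems by (simp add: steps_def)
  finally show ?case using Suc by (simp add: height_def)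
qed

lemma steps_of_height:
  assumes "P \<subseteq> {..<n}" "Q \<subseteq> {..<n} - P"
    and "\<And>j. j \<le> n \<Longrightarrow> L (x + int j * d) = height P Q j + c"
  shows "steps n d L x 1 = P" "steps n d L x (- 1) = Q"
proof -
  have "L (x + int (Suc j) * d) - L (x + int j * d) = of_bool (j \<in> P) - of_bool (j \<in> Q)"
    if "j < n" for j
    using that assms(3)[of j] assms(3)[of "Suc j"] by (simp add: height_def)
  then have "j \<in> steps n d L x s \<longleftrightarrow> j < n \<and> of_bool (j \<in> P) - of_bool (j \<in> Q) = s" for j s
    by (auto simp: steps_def)
  with assms(1,2) show "steps n d L x 1 = P" "steps n d L x (- 1) = Q"
    by (auto simp: of_bool_def split: if_splits)
qed

section \<open>Level functions of simultaneous cores\<close>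

lemma triple_core_level:
  fixes m d :: nat
  assumes "m \<ge> 1" "lam \<in> cores m \<inter> cores (m + d) \<inter> cores (m + 2 * d)"
  defines "L \<equiv> level (int (m + d)) (beads lam)"
  shows "x \<in> beads lam \<longleftrightarrow> 0 \<le> L x"
    and "L (x + k * int (m + d)) = L x - k"
    and "\<bar>L (x + int d) - L x\<bar> \<le> 1"
proof -
  have lam: "lam \<in> partitions" using assms(2) by (simp add: cores_def)
  have closed: "b - int m \<in> beads lam" "b - int (m + d) \<in> beads lam"
    "b - int (m + 2 * d) \<in> beads lam" if "b \<in> beads lam" for b
    using assms(1,2) that cores_iff_beads_closed[OF lam, of m]
      cores_iff_beads_closed[OF lam, of "m + d"] cores_iff_beads_closed[OF lam, of "m + 2 * d"]
    by simp_all
  have n: "int (m + d) > 0" using assms(1) by simp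
  note config = bead_config_beads[OF lam]
  show "x \<in> beads lam \<longleftrightarrow> 0 \<le> L x"
    using le_level_iff[OF config n closed(2), of 0 x] by (simp add: L_def)
  show "L (x + k * int (m + d)) = L x - k"
    unfolding L_def by (rule level_add_multiple[OF config n closed(2)])
  show "\<bar>L (x + int d) - L x\<bar> \<le> 1"
    unfolding L_def of_nat_add
    by (rule level_step_le[OF config]) (use n closed in \<open>auto simp: algebra_simps\<close>)
qed

text \<open>The core is read off from \<open>{x. 0 \<le> L x}\<close>, which is the bead set of a
  partition only after a shift \<open>t\<close>.\<close>

lemma triple_core_of_level:
  fixes m d :: nat and L :: "int \<Rightarrow> int"
  assumes "m \<ge> 1"
    and per: "\<And>x k. L (x + k * int (m + d)) = L x - k"
    and step: "\<And>x. \<bar>L (x + int d) - L x\<bar> \<le> 1"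
  obtains lam t where "lam \<in> cores m \<inter> cores (m + d) \<inter> cores (m + 2 * d)"
    "\<And>x. level (int (m + d)) (beads lam) x = L (x + t)"
proof -
  define n where "n = int (m + d)"
  have n: "n > 0" using assms(1) by (simp add: n_def)
  define B where "B = {x. 0 \<le> L x}"
  \<comment> \<open>\<open>L x + x div n\<close> depends only on \<open>x mod n\<close>, so a bound
    over one period bounds it everywhere.\<close>
  obtain A where A: "\<And>y. y \<in> {0..<n} \<Longrightarrow> \<bar>L y\<bar> \<le> A"
    using finite_imageI[of "{0..<n}" "\<lambda>y. \<bar>L y\<bar>"] by (meson Max_ge finite_atLeastLessThan_int imageI)
  have L_mod: "L x = L (x mod n) - x div n" for x
    using per[of "x mod n" "x div n"] by (simp only: n_def mod_div_mult_eq)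
  have L_bounds: "\<bar>L x + x div n\<bar> \<le> A" for x
    using L_mod[of x] A[of "x mod n"] n by simp
  have "bead_config B"
    unfolding bead_config_def
  proof (intro exI conjI subsetI)
    fix x assume "x \<in> {..(- A) * n}"
    then have "x div n \<le> - A"
      using n zdiv_mono1[of x "(- A) * n" n] by (simp del: mult_minus_left)
    with L_bounds[of x] show "x \<in> B" by (simp add: B_def)
  next
    fix x assume "x \<in> B"
    then have "x div n \<le> A" using L_bounds[of x] by (simp add: B_def)
    show "x \<in> {..(A + 1) * n}"
    proof (rule ccontr)
      assume "x \<notin> {..(A + 1) * n}"
      then have "A + 1 \<le> x div n"
        using n zdiv_mono1[of "(A + 1) * n" x n] by simp
      with \<open>x div n \<le> A\<close> show False by simp
    qed
  qed
  then obtain lam t where lam: "lam \<in> partitions" "\<And>x. x \<in> beads lam \<longleftrightarrow> x + t \<in> B"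
    using bead_config_shift_of_partition by blast
  \<comment> \<open>The three subtrahends are \<open>n - d\<close>, \<open>n\<close> and
    \<open>n + d\<close>. Subtracting \<open>n\<close> raises the level by 1, which makes up for a
    loss of at most 1 in a step of size \<open>d\<close>.\<close>
  have "L (x - int m) \<ge> L x" "L (x - int (m + d)) \<ge> L x" "L (x - int (m + 2 * d)) \<ge> L x" for x
  proof -
    have shift: "L (y - n) = L y + 1" for y
      using per[of y "- 1"] by (simp add: n_def algebra_simps)
    show "L (x - int m) \<ge> L x"
      using step[of x] shift[of "x + int d"] by (simp add: n_def)
    show "L (x - int (m + d)) \<ge> L x"
      using shift[of x] by (simp add: n_def)
    show "L (x - int (m + 2 * d)) \<ge> L x"
      using step[of "x - int d"] shift[of "x - int d"] by (simp add: n_def algebra_simps)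
  qed
  then have "L (x + t) \<le> L (x - int m + t)" "L (x + t) \<le> L (x - int (m + d) + t)"
    "L (x + t) \<le> L (x - int (m + 2 * d) + t)" for x
    by (metis add_diff_eq add.commute)+
  then have "lam \<in> cores m \<inter> cores (m + d) \<inter> cores (m + 2 * d)"
    using assms(1) lam by (auto simp: cores_iff_beads_closed B_def intro: order_trans)
  moreover have "level n (beads lam) x = L (x + t)" for x
  proof (rule level_eqI)
    fix i
    have "L (x + i * n + t) = L (x + t) - i"
      using per[of "x + t" i] by (simp add: n_def algebra_simps)
    then show "x + i * n \<in> beads lam \<longleftrightarrow> i \<le> L (x + t)"
      by (simp add: lam(2) B_def)
  qed
  ultimately show ?thesis using that by (simp add: n_def)
qed

section \<open>Coding a core together with a starting residue\<close>

definition core_code :: "nat \<Rightarrow> nat \<Rightarrow> (nat \<Rightarrow> nat) \<times> int \<Rightarrow> nat set \<times> nat set" where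
  "core_code m d = (\<lambda>(lam, x). let L = level (int (m + d)) (beads lam) in
     (steps (m + d) (int d) L x 1, steps (m + d) (int d) L x (- 1)))"

definition signed_subsets :: "nat \<Rightarrow> nat \<Rightarrow> (nat set \<times> nat set) set" where
  "signed_subsets n d = (SIGMA P:Pow {..<n}. {Q. Q \<subseteq> {..<n} - P \<and> card Q = card P + d})"

text \<open>The walk ends at \<open>x + n * d\<close>, where the level is \<open>L x - d\<close>; so
  the increments sum to \<open>- d\<close>, which is the condition on the two cardinalities.\<close>

lemma core_code_in_signed_subsets:
  assumes "m \<ge> 1" "lam \<in> cores m \<inter> cores (m + d) \<inter> cores (m + 2 * d)"
  shows "core_code m d (lam, x) \<in> signed_subsets (m + d) d"
proof -
  define n where "n = m + d"
  define L where "L = level (int n) (beads lam)"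
  note L = triple_core_level[OF assms, folded n_def, folded L_def]
  let ?P = "steps n (int d) L x 1" and ?Q = "steps n (int d) L x (- 1)"
  have sub: "?P \<subseteq> {..<n}" "?Q \<subseteq> {..<n} - ?P" by (auto simp: steps_def)
  have "int (card ?P) - int (card ?Q) = height ?P ?Q n"
    using sub by (intro height_full[symmetric]) auto
  also have "\<dots> = L (x + int n * int d) - L x"
    using L(3) by (rule height_steps) simp
  also have "\<dots> = - int d"
    using L(2)[of x "int d"] by (simp add: mult.commute)
  finally have "card ?Q = card ?P + d" by simp
  with sub show ?thesis
    by (auto simp: core_code_def signed_subsets_def Let_def n_def L_def)
qed

text \<open>Equal codes make the level functions agree up to a translation and an additive constant
  \<open>e\<close>. The constant amounts to a translation by \<open>e * n\<close>, so the bead sets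
  are shifts of each other, hence equal with total shift 0, and the starts are congruent modulo
  \<open>n\<close>.\<close>

lemma inj_on_core_code:
  assumes "m \<ge> 1" "coprime m d"
  shows "inj_on (core_code m d)
    ((cores m \<inter> cores (m + d) \<inter> cores (m + 2 * d)) \<times> {0..<int (m + d)})"
proof (rule inj_onI, clarify)
  fix lam mu x y
  assume lam: "lam \<in> cores m" "lam \<in> cores (m + d)" "lam \<in> cores (m + 2 * d)"
    and mu: "mu \<in> cores m" "mu \<in> cores (m + d)" "mu \<in> cores (m + 2 * d)"
    and x: "x \<in> {0..<int (m + d)}" and y: "y \<in> {0..<int (m + d)}"
    and eq: "core_code m d (lam, x) = core_code m d (mu, y)"
  define n where "n = m + d"
  define L where "L = level (int n) (beads lam)"
  define L' where "L' = level (int n) (beads mu)"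
  have "lam \<in> cores m \<inter> cores (m + d) \<inter> cores (m + 2 * d)" using lam by simp
  note L = triple_core_level[OF assms(1) this, folded n_def, folded L_def]
  have "mu \<in> cores m \<inter> cores (m + d) \<inter> cores (m + 2 * d)" using mu by simp
  note L' = triple_core_level[OF assms(1) this, folded n_def, folded L'_def]
  have "int n > 0" using assms(1) by (simp add: n_def)
  have "coprime d n"
    using assms(2) unfolding n_def by (metis add.commute coprime_iff_gcd_eq_1 gcd.commute gcd_add2)
  then have "coprime (int d) (int n)" by simp
  have walk: "L (x + int j * int d) - L x = L' (y + int j * int d) - L' y" if "j \<le> n" for j
    using height_steps[of L "int d" j n x] height_steps[of L' "int d" j n y] L(3) L'(3) eq that
    by (simp add: core_code_def Let_def n_def L_def L'_def)
  define e where "e = L x - L' y"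
  have shift: "L (x + z) = L' (y + z) + e" for z
  proof -
    obtain j k where "j < n" "z = int j * int d + k * int n"
      using coprime_int_representation[OF \<open>coprime (int d) (int n)\<close> \<open>int n > 0\<close>, of z]
      by (metis of_nat_less_iff)
    then show ?thesis
      using walk[of j] L(2)[of "x + int j * int d" k] L'(2)[of "y + int j * int d" k]
      by (simp add: e_def add.assoc)
  qed
  have "z \<in> beads lam \<longleftrightarrow> z + (y - x - e * int n) \<in> beads mu" for z
    using shift[of "z - x"] L(1)[of z] L'(1)[of "z + (y - x - e * int n)"]
      L'(2)[of "y + (z - x)" "- e"]
    by (simp add: algebra_simps)
  then have "lam = mu \<and> y - x - e * int n = 0"
    using lam(1) mu(1) by (intro beads_shift_unique) (auto simp: cores_def)
  moreover from this have "x mod int n = y mod int n"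
    by (metis add.commute diff_add_cancel diff_eq_diff_eq mod_mult_self1 right_minus_eq)
  then have "x = y" using x y by (simp add: n_def)
  ultimately show "lam = mu \<and> x = y" by simp
qed

text \<open>The heights extend to a level function \<open>L\<close>, whose core has levels
  \<open>L (x + t)\<close>. Starting at the residue of \<open>- t\<close> undoes the shift up to a
  multiple of \<open>n\<close>, which changes heights only by a constant.\<close>

lemma core_code_surj:
  assumes "m \<ge> 1" "coprime m d" "(P, Q) \<in> signed_subsets (m + d) d"
  obtains lam x where "lam \<in> cores m \<inter> cores (m + d) \<inter> cores (m + 2 * d)"
    "x \<in> {0..<int (m + d)}" "core_code m d (lam, x) = (P, Q)"
proof -
  define n where "n = m + d"
  have "n > 0" using assms(1) by (simp add: n_def)
  have sub: "P \<subseteq> {..<n}" "Q \<subseteq> {..<n} - P" and card: "card Q = card P + d"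
    using assms(3) by (auto simp: signed_subsets_def n_def)
  have "coprime d n"
    using assms(2) unfolding n_def by (metis add.commute coprime_iff_gcd_eq_1 gcd.commute gcd_add2)
  moreover have "height P Q n = - int d"
    using sub card height_full[of P n Q] by auto
  ultimately obtain L where L: "\<And>j. j \<le> n \<Longrightarrow> L (int j * int d) = height P Q j"
    and per: "\<And>x k. L (x + k * int n) = L x - k"
    using height_extension \<open>n > 0\<close> by metis
  have "\<bar>L (x + int d) - L x\<bar> \<le> 1" for x
  proof -
    obtain j k where j: "j < n" and x: "x = int j * int d + k * int n"
      using coprime_int_representation[of "int d" "int n" x] \<open>coprime d n\<close> \<open>n > 0\<close>
      by (metis coprime_int_iff of_nat_0_less_iff of_nat_less_iff)
    have "L (x + int d) = height P Q (Suc j) - k"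
      using L[of "Suc j"] per[of "int (Suc j) * int d" k] j by (simp add: x algebra_simps)
    moreover have "L x = height P Q j - k"
      using L[of j] per[of "int j * int d" k] j by (simp add: x)
    ultimately show ?thesis by (simp add: height_def)
  qed
  then obtain lam t where lam: "lam \<in> cores m \<inter> cores (m + d) \<inter> cores (m + 2 * d)"
    and level: "\<And>x. level (int n) (beads lam) x = L (x + t)"
    using triple_core_of_level[OF assms(1), of L d] per unfolding n_def by blast
  define x where "x = (- t) mod int n"
  define q where "q = - ((- t) div int n)"
  have x: "x = q * int n - t"
    unfolding x_def q_def by (simp add: minus_div_mult_eq_mod[symmetric])
  have "L (x + int j * int d + t) = height P Q j + (- q)" if "j \<le> n" for j
    using L[OF that] per[of "int j * int d" q] by (simp add: x algebra_simps)
  then have "steps n (int d) (level (int n) (beads lam)) x 1 = P"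
    "steps n (int d) (level (int n) (beads lam)) x (- 1) = Q"
    using steps_of_height[OF sub, of "level (int n) (beads lam)" x "int d" "- q"]
    by (simp_all add: level)
  then have "core_code m d (lam, x) = (P, Q)"
    by (simp add: core_code_def Let_def n_def)
  moreover have "x \<in> {0..<int n}" using \<open>n > 0\<close> by (simp add: x_def)
  ultimately show ?thesis using that lam by (simp add: n_def)
qed

section \<open>Counting the codes\<close>

lemma finite_signed_subsets: "finite (signed_subsets n d)"
  unfolding signed_subsets_def by (rule finite_SigmaI) auto

lemma card_signed_subsets:
  "card (signed_subsets n d) = (\<Sum>i\<le>n. (n choose i) * ((n - i) choose (i + d)))"
proof -
  have "card {Q. Q \<subseteq> {..<n} - P \<and> card Q = card P + d} = (n - card P) choose (card P + d)"
    if "P \<subseteq> {..<n}" for P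
    using that n_subsets[of "{..<n} - P" "card P + d"]
    by (simp add: card_Diff_subset finite_subset)
  then have "card (signed_subsets n d)
      = (\<Sum>P\<in>Pow {..<n}. (n - card P) choose (card P + d))"
    unfolding signed_subsets_def by (subst card_SigmaI) (auto intro!: sum.cong)
  also have "\<dots> = (\<Sum>i\<le>n. \<Sum>P | P \<in> Pow {..<n} \<and> card P = i. (n - card P) choose (card P + d))"
    by (rule sum.group[symmetric]) (auto dest: card_mono[rotated])
  also have "\<dots> = (\<Sum>i\<le>n. (n choose i) * ((n - i) choose (i + d)))"
    by (rule sum.cong) (use n_subsets[of "{..<n}"] in auto)
  finally show ?thesis .
qed

lemma choose_mult_choose_eq_multinomial:
  assumes "i + k \<le> n"
  shows "real ((n choose i) * ((n - i) choose k)) = multinomial n i k (n - i - k)"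
  using assms by (simp add: multinomial_def binomial_fact)

lemma card_signed_subsets_multinomial:
  "real (card (signed_subsets (m + d) d))
    = (\<Sum>i = 0..m div 2. multinomial (m + d) i (i + d) (m - 2 * i))"
proof -
  have "real (card (signed_subsets (m + d) d))
      = (\<Sum>i\<le>m + d. real ((m + d choose i) * ((m + d - i) choose (i + d))))"
    by (simp add: card_signed_subsets)
  \<comment> \<open>For \<open>i > m div 2\<close> the number \<open>i + d\<close> exceeds
    \<open>m + d - i\<close>, so the second binomial coefficient is 0.\<close>
  also have "\<dots> = (\<Sum>i = 0..m div 2. real ((m + d choose i) * ((m + d - i) choose (i + d))))"
    by (rule sum.mono_neutral_right) (auto simp: not_le)
  also have "\<dots> = (\<Sum>i = 0..m div 2. multinomial (m + d) i (i + d) (m - 2 * i))"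
  proof (rule sum.cong)
    fix i assume "i \<in> {0..m div 2}"
    then have "i + (i + d) \<le> m + d" by auto
    moreover have "m + d - i - (i + d) = m - 2 * i" by simp
    ultimately show "real ((m + d choose i) * ((m + d - i) choose (i + d)))
        = multinomial (m + d) i (i + d) (m - 2 * i)"
      using choose_mult_choose_eq_multinomial[of i "i + d" "m + d"] by simp
  qed simp
  finally show ?thesis .
qed

theorem theorem1p6:
  fixes m d :: nat
  assumes "m \<ge> 1" and "d \<ge> 1" and "coprime m d"
  shows "finite (cores m \<inter> cores (m + d) \<inter> cores (m + 2 * d)) \<and>
    real (card (cores m \<inter> cores (m + d) \<inter> cores (m + 2 * d))) =
      1 / real (m + d) * (\<Sum>i = 0..m div 2. multinomial (m + d) i (i + d) (m - 2 * i))"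
proof -
  let ?C = "cores m \<inter> cores (m + d) \<inter> cores (m + 2 * d)"
  have "core_code m d ` (?C \<times> {0..<int (m + d)}) = signed_subsets (m + d) d"
  proof
    show "core_code m d ` (?C \<times> {0..<int (m + d)}) \<subseteq> signed_subsets (m + d) d"
      using core_code_in_signed_subsets[OF assms(1)] by auto
    show "signed_subsets (m + d) d \<subseteq> core_code m d ` (?C \<times> {0..<int (m + d)})"
    proof
      fix z assume z: "z \<in> signed_subsets (m + d) d"
      obtain P Q where "z = (P, Q)" by (cases z)
      with z core_code_surj[OF assms(1,3), of P Q]
      obtain lam x where "lam \<in> ?C" "x \<in> {0..<int (m + d)}" "core_code m d (lam, x) = z"
        by metis
      then show "z \<in> core_code m d ` (?C \<times> {0..<int (m + d)})"
        by (intro image_eqI[of _ _ "(lam, x)"]) auto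
    qed
  qed
  then have bij: "bij_betw (core_code m d) (?C \<times> {0..<int (m + d)}) (signed_subsets (m + d) d)"
    using inj_on_core_code[OF assms(1,3)] by (simp add: bij_betw_def)
  then have "finite (?C \<times> {0..<int (m + d)})"
    using bij_betw_finite finite_signed_subsets by blast
  \<comment> \<open>The second factor \<open>{0..<int (m + d)}\<close> is nonempty, so finiteness
    passes from the product to \<open>?C\<close>.\<close>
  then have "finite ?C"
    using assms(1) by (auto simp: finite_cartesian_product_iff)
  moreover have "card ?C * (m + d) = card (signed_subsets (m + d) d)"
    using bij_betw_same_card[OF bij]
    by (simp only: card_cartesian_product card_atLeastLessThan_int diff_0_right nat_int)
  then have "real (card ?C) * real (m + d)
      = (\<Sum>i = 0..m div 2. multinomial (m + d) i (i + d) (m - 2 * i))"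
    unfolding card_signed_subsets_multinomial[symmetric] by (metis of_nat_mult)
  ultimately show ?thesis
    using assms(1) by (simp add: field_simps)
qed

end
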